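(* Let $I \subseteq \mathbb{R}$ be an open interval, let $a \in I$, and let $S_1, S_2 : I \to \mathbb{R}$ be solutions to equation $\mathbf{XX}$ on $I$ all of whose zeros are isolated. If $S_1(a) = S_2(a) = 0$ and $S_1''(a) = S_2''(a)$, then $S_1 = S_2$ on $I$. (That is, a solution to $\mathbf{XX}$ that vanishes at a point is uniquely determined by the value of its second derivative there.)
   Context: Everything is real: $t$ is a real variable and solutions are real-valued. Equation $\mathbf{XX}$ is $$S'' = \frac{(S')^2}{2S} + 4 S^2 + 2 t S,$$ where the ratio $(S')^2/(2S)$ is understood as a limit at zeros of $S$. Precisely, a solution to $\mathbf{XX}$ on an open interval $I$ is a twice-differentiable function $S : I \to \mathbb{R}$ such that (i) at every $t \in I$ with $S(t) \neq 0$ one has $S''(t) = \frac{S'(t)^2}{2S(t)} + 4S(t)^2 + 2tS(t)$; and (ii) at every isolated zero $a \in I$ of $S$ the limit $\lim_{t \to a,\, t\neq a} \frac{S'(t)^2}{2S(t)}$ exists as a real number and $S''(a) = \lim_{t \to a} \frac{S'(t)^2}{2S(t)} + 4S(a)^2 + 2aS(a)$. *)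

theory Defs
  imports "HOL-Analysis.Analysis"
begin

(* A function S : I -> R is represented by a total function of which only the values on I
   matter: I is going to be open, so that derivatives and limits at points of I depend only
   on the restriction of S to I. *)

definition zeros_on :: "(real \<Rightarrow> real) \<Rightarrow> real set \<Rightarrow> real set" where
  "zeros_on S I = {t \<in> I. S t = 0}"

definition twice_differentiable_on :: "(real \<Rightarrow> real) \<Rightarrow> real set \<Rightarrow> bool" where
  "twice_differentiable_on S I \<longleftrightarrow> S differentiable_on I \<and> deriv S differentiable_on I"

definition XX_solution_on :: "(real \<Rightarrow> real) \<Rightarrow> real set \<Rightarrow> bool" where
  "XX_solution_on S I \<longleftrightarrow>
     twice_differentiable_on S I \<and>
     (\<forall>t\<in>I. S t \<noteq> 0 \<longrightarrow>
        deriv (deriv S) t = (deriv S t)\<^sup>2 / (2 * S t) + 4 * (S t)\<^sup>2 + 2 * t * S t) \<and>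
     (\<forall>a\<in>I. a isolated_in zeros_on S I \<longrightarrow>
        (\<exists>L. ((\<lambda>t. (deriv S t)\<^sup>2 / (2 * S t)) \<longlongrightarrow> L) (at a) \<and>
             deriv (deriv S) a = L + 4 * (S a)\<^sup>2 + 2 * a * S a))"

end

theory Submission
  imports Defs
begin

text \<open>
  Away from its zeros, a positive solution of \<open>XX\<close> is the square of a function \<open>w\<close> with
  \<open>w'' = 2 w ^ 3 + t w\<close> (Painleve II with parameter zero), and a negative one is minus the square
  of a solution of \<open>w'' = - 2 w ^ 3 + t w\<close>. These equations are regular: their right-hand sides are
  locally Lipschitz in \<open>w\<close>, so \<open>w\<close> is determined by its initial value and slope, even when the
  initial point is only approached from one side (\<open>PII_unique_at_right\<close>, by Gronwall).

  At an isolated zero \<open>a\<close> of \<open>S\<close> the limit condition forces \<open>S' a = 0\<close> and says that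
  \<open>w'\<close>, whose square is \<open>S'\<^sup>2 / (4 S)\<close>, has absolute value tending to the square root of
  \<open>S'' a / 2\<close> (for \<open>S > 0\<close>). Thus \<open>S'' a\<close> carries the slope of \<open>w\<close> at its zero, up to a sign which
  is fixed by the side from which \<open>a\<close> is approached. Moreover \<open>S'' a \<noteq> 0\<close>, because otherwise \<open>w\<close>
  would be the zero solution and \<open>a\<close> would not be isolated (\<open>XX_germ_zero_second_deriv_nonzero\<close>). Hence two
  solutions with the same value, first and second derivative at a point agree near that point
  (\<open>XX_germ_unique\<close>), whether or not it is a zero.

  The theorem follows by a connectedness argument. At a point where coincidences of
  \<open>(S1, S1')\<close> with \<open>(S2, S2')\<close> accumulate, the second derivatives agree too, so that local
  uniqueness applies again. Therefore at every point of the interval the two solutions either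
  coincide nearby or have no such coincidence nearby; both alternatives are open.

  The signs are handled by symmetry. Two parameters are put into the equation,
  \<open>S'' = S'\<^sup>2 / (2 S) + 4 m S\<^sup>2 + 2 k t S\<close>; then \<open>S \<mapsto> - S\<close> changes the sign of \<open>m\<close> and
  \<open>t \<mapsto> - t\<close> that of \<open>k\<close>, so it is enough to look at positive solutions on the right of a point.
\<close>

section \<open>One-sided uniqueness for Painleve II\<close>

text \<open>The function \<open>E t * exp (- K * t)\<close> is nonincreasing and tends to zero at its left end.\<close>

lemma gronwall_at_right:
  fixes E E' :: "real \<Rightarrow> real"
  assumes ev: "\<forall>\<^sub>F t in at_right a. 0 \<le> E t \<and> (E has_real_derivative E' t) (at t) \<and> E' t \<le> K * E t"
    and lim: "(E \<longlongrightarrow> 0) (at_right a)"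
  shows "\<forall>\<^sub>F t in at_right a. E t = 0"
proof -
  obtain b where "a < b" and b: "\<And>t. a < t \<Longrightarrow> t < b \<Longrightarrow>
      0 \<le> E t \<and> (E has_real_derivative E' t) (at t) \<and> E' t \<le> K * E t"
    using ev unfolding eventually_at_right_field by blast
  define h where "h = (\<lambda>t. E t * exp (- K * t))"
  have der: "(h has_real_derivative (E' t - K * E t) * exp (- K * t)) (at t)" if "a < t" "t < b" for t
    unfolding h_def using b[OF that]
    by (auto intro!: derivative_eq_intros simp: algebra_simps)
  have anti: "h t \<le> h s" if "a < s" "s \<le> t" "t < b" for s t
  proof (rule DERIV_nonpos_imp_nonincreasing[OF \<open>s \<le> t\<close>])
    fix x assume x: "s \<le> x" "x \<le> t"
    with that have "a < x" "x < b" by auto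
    from der[OF this] b[OF this] show "\<exists>y. (h has_real_derivative y) (at x) \<and> y \<le> 0"
      by (intro exI[of _ "(E' x - K * E x) * exp (- K * x)"]) (auto simp: mult_le_0_iff)
  qed
  have hlim: "(h \<longlongrightarrow> 0 * exp (- K * a)) (at_right a)"
    unfolding h_def by (intro tendsto_intros lim)
  have "E t = 0" if t: "a < t" "t < b" for t
  proof -
    have "\<forall>\<^sub>F s in at_right a. h t \<le> h s"
      unfolding eventually_at_right_field using t anti by (intro exI[of _ t]) auto
    from tendsto_lowerbound[OF hlim this] have "h t \<le> 0" by simp
    then have "E t \<le> 0" by (simp add: h_def mult_le_0_iff)
    with b[OF t] show ?thesis by auto
  qed
  then show ?thesis unfolding eventually_at_right_field using \<open>a < b\<close> by blast
qed

definition PII :: "real \<Rightarrow> real \<Rightarrow> (real \<Rightarrow> real) \<Rightarrow> (real \<Rightarrow> real) \<Rightarrow> real \<Rightarrow> bool" where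
  "PII m k w v t \<longleftrightarrow> (w has_real_derivative v t) (at t) \<and>
     (v has_real_derivative 2 * m * w t ^ 3 + k * t * w t) (at t)"

text \<open>
  The difference of two solutions satisfies a linear equation \<open>d'' = g t * d\<close> whose coefficient
  is bounded near \<open>a\<close>, so that Gronwall applies to the energy \<open>d\<^sup>2 + (d')\<^sup>2\<close>. Initial data enter as
  one-sided limits because, in the application, \<open>w\<close> is a square root that solves the equation
  only on the right of \<open>a\<close>.
\<close>

lemma PII_unique_at_right:
  assumes sol: "\<forall>\<^sub>F t in at_right a. PII m k w1 v1 t" "\<forall>\<^sub>F t in at_right a. PII m k w2 v2 t"
    and w: "(w1 \<longlongrightarrow> l) (at_right a)" "(w2 \<longlongrightarrow> l) (at_right a)"
    and v: "(v1 \<longlongrightarrow> p) (at_right a)" "(v2 \<longlongrightarrow> p) (at_right a)"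
  shows "\<forall>\<^sub>F t in at_right a. w1 t = w2 t \<and> v1 t = v2 t"
proof -
  define g where "g = (\<lambda>t. 2 * m * ((w1 t)\<^sup>2 + w1 t * w2 t + (w2 t)\<^sup>2) + k * t)"
  define d where "d = (\<lambda>t. w1 t - w2 t)"
  define e where "e = (\<lambda>t. v1 t - v2 t)"
  define M where "M = \<bar>2 * m * (l\<^sup>2 + l * l + l\<^sup>2) + k * a\<bar> + 1"
  have "((\<lambda>t. \<bar>g t\<bar>) \<longlongrightarrow> \<bar>2 * m * (l\<^sup>2 + l * l + l\<^sup>2) + k * a\<bar>) (at_right a)"
    unfolding g_def by (intro tendsto_intros w)
  then have bd: "\<forall>\<^sub>F t in at_right a. \<bar>g t\<bar> < M"
    by (rule order_tendstoD) (simp add: M_def)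
  have "((\<lambda>t. (d t)\<^sup>2 + (e t)\<^sup>2) \<longlongrightarrow> (l - l)\<^sup>2 + (p - p)\<^sup>2) (at_right a)"
    unfolding d_def e_def by (intro tendsto_intros w v)
  then have lim: "((\<lambda>t. (d t)\<^sup>2 + (e t)\<^sup>2) \<longlongrightarrow> 0) (at_right a)" by simp
  have "\<forall>\<^sub>F t in at_right a. (d t)\<^sup>2 + (e t)\<^sup>2 = 0"
  proof (rule gronwall_at_right[OF _ lim])
    show "\<forall>\<^sub>F t in at_right a. 0 \<le> (d t)\<^sup>2 + (e t)\<^sup>2 \<and>
        ((\<lambda>t. (d t)\<^sup>2 + (e t)\<^sup>2) has_real_derivative 2 * d t * e t * (1 + g t)) (at t) \<and>
        2 * d t * e t * (1 + g t) \<le> (1 + M) * ((d t)\<^sup>2 + (e t)\<^sup>2)"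
      using sol bd
    proof eventually_elim
      case (elim t)
      have D: "(d has_real_derivative e t) (at t)"
        unfolding d_def e_def using elim by (auto simp: PII_def intro!: derivative_intros)
      have "(e has_real_derivative (2 * m * w1 t ^ 3 + k * t * w1 t) - (2 * m * w2 t ^ 3 + k * t * w2 t)) (at t)"
        unfolding e_def using elim by (auto simp: PII_def intro!: derivative_intros)
      also have "(2 * m * w1 t ^ 3 + k * t * w1 t) - (2 * m * w2 t ^ 3 + k * t * w2 t) = g t * d t"
        unfolding g_def d_def by (simp add: algebra_simps power2_eq_square power3_eq_cube)
      finally have E: "(e has_real_derivative g t * d t) (at t)" .
      have 1: "((\<lambda>t. (d t)\<^sup>2 + (e t)\<^sup>2) has_real_derivative 2 * d t * e t * (1 + g t)) (at t)"
        by (rule derivative_eq_intros D E refl)+ (simp add: algebra_simps)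
      have "2 * d t * e t * (1 + g t) \<le> \<bar>2 * d t * e t\<bar> * \<bar>1 + g t\<bar>"
        by (metis abs_ge_self abs_mult)
      also have "\<dots> \<le> ((d t)\<^sup>2 + (e t)\<^sup>2) * (1 + M)"
      proof (rule mult_mono)
        have "0 \<le> (\<bar>d t\<bar> - \<bar>e t\<bar>)\<^sup>2" by simp
        then show "\<bar>2 * d t * e t\<bar> \<le> (d t)\<^sup>2 + (e t)\<^sup>2"
          by (simp add: power2_diff abs_mult)
      qed (use elim in auto)
      finally show ?case using 1 by (simp add: mult.commute)
    qed
  qed
  then show ?thesis
    by eventually_elim (simp add: sum_power2_eq_zero_iff d_def e_def)
qed

section \<open>Equation XX with its symmetries\<close>

definition XX_ode :: "real \<Rightarrow> real \<Rightarrow> (real \<Rightarrow> real) \<Rightarrow> (real \<Rightarrow> real) \<Rightarrow> real \<Rightarrow> bool" where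
  "XX_ode m k S D t \<longleftrightarrow> S t \<noteq> 0 \<and> (S has_real_derivative D t) (at t) \<and>
     (D has_real_derivative (D t)\<^sup>2 / (2 * S t) + 4 * m * (S t)\<^sup>2 + 2 * k * t * S t) (at t)"

lemma PII_sqrt:
  assumes "XX_ode m k S D t" "0 < S t"
  shows "PII m k (\<lambda>t. sqrt (S t)) (\<lambda>t. D t / (2 * sqrt (S t))) t"
proof -
  have S: "(S has_real_derivative D t) (at t)"
    and D: "(D has_real_derivative (D t)\<^sup>2 / (2 * S t) + 4 * m * (S t)\<^sup>2 + 2 * k * t * S t) (at t)"
    using assms by (auto simp: XX_ode_def)
  have w: "((\<lambda>t. sqrt (S t)) has_real_derivative D t / (2 * sqrt (S t))) (at t)"
    using assms(2) by (auto intro!: derivative_eq_intros S simp: field_simps)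
  define r where "r = sqrt (S t)"
  have r: "r > 0" "S t = r\<^sup>2" using assms(2) by (auto simp: r_def)
  have "((\<lambda>t. D t / (2 * sqrt (S t))) has_real_derivative
     (((D t)\<^sup>2 / (2 * S t) + 4 * m * (S t)\<^sup>2 + 2 * k * t * S t) * (2 * r)
       - D t * (2 * (D t / (2 * r)))) / ((2 * r) * (2 * r))) (at t)"
    unfolding r_def
    by (rule DERIV_divide[OF D DERIV_cmult[OF w]]) (use assms(2) in auto)
  also have "(((D t)\<^sup>2 / (2 * S t) + 4 * m * (S t)\<^sup>2 + 2 * k * t * S t) * (2 * r)
       - D t * (2 * (D t / (2 * r)))) / ((2 * r) * (2 * r)) = 2 * m * r ^ 3 + k * t * r"
    using r(1) unfolding r(2) by (simp add: field_simps power2_eq_square power3_eq_cube)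
  finally show ?thesis using w by (simp add: PII_def r_def)
qed

text \<open>
  Being a solution near \<open>t0\<close> with at most an isolated zero there: \<open>D\<close> stands for the derivative and
  \<open>c\<close> for the second derivative at \<open>t0\<close>. At a zero the terms \<open>4 S\<^sup>2\<close> and \<open>2 t S\<close> vanish, which leaves
  \<open>c\<close> alone as the required limit.
\<close>

definition XX_germ :: "real \<Rightarrow> real \<Rightarrow> real \<Rightarrow> (real \<Rightarrow> real) \<Rightarrow> (real \<Rightarrow> real) \<Rightarrow> real \<Rightarrow> bool" where
  "XX_germ m k t0 S D c \<longleftrightarrow> (\<forall>\<^sub>F t in at t0. XX_ode m k S D t) \<and>
     (S has_real_derivative D t0) (at t0) \<and> (D has_real_derivative c) (at t0) \<and>
     (S t0 = 0 \<longrightarrow> ((\<lambda>t. (D t)\<^sup>2 / (2 * S t)) \<longlongrightarrow> c) (at t0))"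

lemma XX_ode_uminus:
  assumes "XX_ode m k S D t"
  shows "XX_ode (- m) k (\<lambda>t. - S t) (\<lambda>t. - D t) t"
  using assms unfolding XX_ode_def by (auto intro!: derivative_eq_intros)

lemma XX_germ_uminus:
  assumes "XX_germ m k t0 S D c"
  shows "XX_germ (- m) k t0 (\<lambda>t. - S t) (\<lambda>t. - D t) (- c)"
  using assms unfolding XX_germ_def
  by (auto intro!: derivative_eq_intros XX_ode_uminus tendsto_minus elim!: eventually_mono)

lemma XX_ode_reflect:
  assumes "XX_ode m k S D (- t)"
  shows "XX_ode m (- k) (\<lambda>t. S (- t)) (\<lambda>t. - D (- t)) t"
  using assms unfolding XX_ode_def by (auto simp: DERIV_mirror intro!: derivative_eq_intros)

lemma XX_germ_reflect:
  assumes "XX_germ m k t0 S D c"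
  shows "XX_germ m (- k) (- t0) (\<lambda>t. S (- t)) (\<lambda>t. - D (- t)) c"
proof -
  have 1: "\<forall>\<^sub>F t in at t0. XX_ode m (- k) (\<lambda>t. S (- t)) (\<lambda>t. - D (- t)) (- t)"
    using assms unfolding XX_germ_def by (auto intro!: XX_ode_reflect elim!: eventually_mono)
  have 2: "((\<lambda>t. S (- t)) has_real_derivative - D t0) (at (- t0))"
    "((\<lambda>t. D (- t)) has_real_derivative - c) (at (- t0))"
    using assms DERIV_mirror[where f = S and x = "- t0"] DERIV_mirror[where f = D and x = "- t0"]
    by (auto simp: XX_germ_def)
  from DERIV_minus[OF 2(2)]
  have 3: "((\<lambda>t. - D (- t)) has_real_derivative c) (at (- t0))" by simp
  have 4: "\<forall>\<^sub>F t in at (- t0). XX_ode m (- k) (\<lambda>t. S (- t)) (\<lambda>t. - D (- t)) t"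
    using 1 by (simp add: filtermap_at_minus[symmetric, of t0] eventually_filtermap)
  have "((\<lambda>t. (- D (- t))\<^sup>2 / (2 * S (- t))) \<longlongrightarrow> c) (at (- t0))" if "S t0 = 0"
    using assms that
    by (simp add: XX_germ_def filtermap_at_minus[symmetric, of t0] filterlim_filtermap)
  then show ?thesis using 2(1) 3 4 by (simp add: XX_germ_def)
qed

section \<open>Local uniqueness at a point\<close>

lemma XX_ode_unique_at_right_pos:
  assumes "\<forall>\<^sub>F t in at_right a. XX_ode m k S1 D1 t \<and> 0 < S1 t"
    and "\<forall>\<^sub>F t in at_right a. XX_ode m k S2 D2 t \<and> 0 < S2 t"
    and w: "((\<lambda>t. sqrt (S1 t)) \<longlongrightarrow> l) (at_right a)" "((\<lambda>t. sqrt (S2 t)) \<longlongrightarrow> l) (at_right a)"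
    and v: "((\<lambda>t. D1 t / (2 * sqrt (S1 t))) \<longlongrightarrow> p) (at_right a)"
      "((\<lambda>t. D2 t / (2 * sqrt (S2 t))) \<longlongrightarrow> p) (at_right a)"
  shows "\<forall>\<^sub>F t in at_right a. S1 t = S2 t \<and> D1 t = D2 t"
proof -
  have "\<forall>\<^sub>F t in at_right a. PII m k (\<lambda>t. sqrt (S1 t)) (\<lambda>t. D1 t / (2 * sqrt (S1 t))) t"
    "\<forall>\<^sub>F t in at_right a. PII m k (\<lambda>t. sqrt (S2 t)) (\<lambda>t. D2 t / (2 * sqrt (S2 t))) t"
    by (rule eventually_mono[OF assms(1)], simp add: PII_sqrt)
      (rule eventually_mono[OF assms(2)], simp add: PII_sqrt)
  from PII_unique_at_right[OF this w v] show ?thesis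
    using assms(1,2) by eventually_elim auto
qed

lemma XX_germ_at_right:
  assumes "XX_germ m k t0 S D c"
  shows "\<forall>\<^sub>F t in at_right t0. XX_ode m k S D t" "(S \<longlongrightarrow> S t0) (at_right t0)" "(D \<longlongrightarrow> D t0) (at_right t0)"
proof -
  have "isCont S t0" "isCont D t0"
    using assms by (auto simp: XX_germ_def intro: DERIV_isCont)
  then show "(S \<longlongrightarrow> S t0) (at_right t0)" "(D \<longlongrightarrow> D t0) (at_right t0)"
    by (auto simp: isCont_def intro: tendsto_within_subset)
  show "\<forall>\<^sub>F t in at_right t0. XX_ode m k S D t"
    using assms by (auto simp: XX_germ_def eventually_at_split)
qed

text \<open>Near the zero, \<open>D\<^sup>2\<close> is the product of the convergent quotient with \<open>2 * S\<close>, which tends to zero.\<close>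

lemma XX_germ_zero_deriv:
  assumes germ: "XX_germ m k t0 S D c" and "S t0 = 0"
  shows "D t0 = 0"
proof -
  have "((\<lambda>t. (D t)\<^sup>2 / (2 * S t)) \<longlongrightarrow> c) (at_right t0)"
    using assms by (auto simp: XX_germ_def filterlim_at_split)
  then have "((\<lambda>t. (D t)\<^sup>2 / (2 * S t) * (2 * S t)) \<longlongrightarrow> c * (2 * S t0)) (at_right t0)"
    by (intro tendsto_intros XX_germ_at_right[OF germ])
  moreover have "\<forall>\<^sub>F t in at_right t0. (D t)\<^sup>2 / (2 * S t) * (2 * S t) = (D t)\<^sup>2"
    using XX_germ_at_right(1)[OF germ] by eventually_elim (simp add: XX_ode_def)
  ultimately have "((\<lambda>t. (D t)\<^sup>2) \<longlongrightarrow> 0) (at_right t0)"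
    using \<open>S t0 = 0\<close> by (simp add: tendsto_cong)
  then have "(D \<longlongrightarrow> 0) (at_right t0)" by simp
  with XX_germ_at_right(3)[OF germ] show ?thesis
    by (intro tendsto_unique[of "at_right t0"]) auto
qed

lemma XX_germ_slope_limit:
  assumes germ: "XX_germ m k t0 S D c" and "S t0 = 0"
    and pos: "\<forall>\<^sub>F t in at_right t0. 0 < S t"
  shows "((\<lambda>t. \<bar>D t / (2 * sqrt (S t))\<bar>) \<longlongrightarrow> sqrt (c / 2)) (at_right t0)"
proof -
  have "((\<lambda>t. (D t)\<^sup>2 / (2 * S t)) \<longlongrightarrow> c) (at_right t0)"
    using assms by (auto simp: XX_germ_def filterlim_at_split)
  then have "((\<lambda>t. sqrt ((D t)\<^sup>2 / (2 * S t) / 2)) \<longlongrightarrow> sqrt (c / 2)) (at_right t0)"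
    by (intro tendsto_intros) auto
  moreover have "\<forall>\<^sub>F t in at_right t0. sqrt ((D t)\<^sup>2 / (2 * S t) / 2) = \<bar>D t / (2 * sqrt (S t))\<bar>"
    using pos by eventually_elim (simp add: real_sqrt_divide real_sqrt_mult abs_mult)
  ultimately show ?thesis by (simp add: tendsto_cong)
qed

text \<open>Otherwise \<open>sqrt S\<close> would have the same one-sided initial data as the zero solution of Painleve II.\<close>

lemma XX_germ_flat_zero_not_pos:
  assumes germ: "XX_germ m k t0 S D 0" and "S t0 = 0"
  shows "\<not> (\<forall>\<^sub>F t in at_right t0. 0 < S t)"
proof
  assume pos: "\<forall>\<^sub>F t in at_right t0. 0 < S t"
  have "((\<lambda>t. sqrt (S t)) \<longlongrightarrow> sqrt (S t0)) (at_right t0)"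
    by (intro tendsto_intros XX_germ_at_right[OF germ])
  then have w: "((\<lambda>t. sqrt (S t)) \<longlongrightarrow> 0) (at_right t0)" using \<open>S t0 = 0\<close> by simp
  have v: "((\<lambda>t. D t / (2 * sqrt (S t))) \<longlongrightarrow> 0) (at_right t0)"
    using XX_germ_slope_limit[OF assms pos] by (simp only: tendsto_rabs_zero_iff div_0 real_sqrt_zero)
  have "\<forall>\<^sub>F t in at_right t0. PII m k (\<lambda>t. sqrt (S t)) (\<lambda>t. D t / (2 * sqrt (S t))) t"
    using XX_germ_at_right(1)[OF germ] pos by eventually_elim (rule PII_sqrt)
  moreover have "\<forall>\<^sub>F t in at_right t0. PII m k (\<lambda>t. 0) (\<lambda>t. 0) t"
    by (simp add: PII_def)
  ultimately have "\<forall>\<^sub>F t in at_right t0. sqrt (S t) = 0 \<and> D t / (2 * sqrt (S t)) = 0"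
    by (rule PII_unique_at_right[OF _ _ w tendsto_const v tendsto_const])
  with pos have "\<forall>\<^sub>F t in at_right t0. False"
    by eventually_elim auto
  then show False by simp
qed

text \<open>
  A solution without zeros on a one-sided neighbourhood has a constant sign there, so this
  reduces to the positive case.
\<close>

lemma XX_germ_zero_second_deriv_nonzero:
  assumes germ: "XX_germ m k t0 S D c" and zero: "S t0 = 0"
  shows "c \<noteq> 0"
proof
  assume "c = 0"
  from XX_germ_at_right(1)[OF germ] obtain b where "t0 < b"
    and b: "\<And>t. t0 < t \<Longrightarrow> t < b \<Longrightarrow> XX_ode m k S D t"
    unfolding eventually_at_right_field by blast
  have "isCont S t" if "t0 < t" "t < b" for t
    using b[OF that] by (auto simp: XX_ode_def intro: DERIV_isCont)
  then have conn: "connected (S ` {t0<..<b})"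
    by (intro connected_continuous_image continuous_at_imp_continuous_on) auto
  have nz: "0 \<notin> S ` {t0<..<b}" using b by (auto simp: XX_ode_def)
  have "(\<forall>t\<in>{t0<..<b}. 0 < S t) \<or> (\<forall>t\<in>{t0<..<b}. S t < 0)"
  proof (rule ccontr)
    assume "\<not> ?thesis"
    then obtain x y where "x \<in> {t0<..<b}" "y \<in> {t0<..<b}" "S x \<le> 0" "0 \<le> S y"
      by (auto simp: not_less)
    then show False using connectedD_interval[OF conn, of "S x" "S y" 0] nz by blast
  qed
  then consider "\<forall>\<^sub>F t in at_right t0. 0 < S t" | "\<forall>\<^sub>F t in at_right t0. 0 < - S t"
    using \<open>t0 < b\<close> unfolding eventually_at_right_field by force
  then show False
  proof cases
    case 1
    then show False using XX_germ_flat_zero_not_pos germ zero \<open>c = 0\<close> by blast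
  next
    case 2
    then show False
      using XX_germ_flat_zero_not_pos[of "- m" k t0 "\<lambda>t. - S t" "\<lambda>t. - D t"] XX_germ_uminus[OF germ] zero \<open>c = 0\<close>
      by simp
  qed
qed

text \<open>
  The slope of \<open>sqrt S\<close> is known up to sign; the sign on the right is positive because \<open>D\<close> vanishes
  at \<open>t0\<close> with positive derivative \<open>c\<close>.
\<close>

lemma XX_germ_zero_limits_pos:
  assumes germ: "XX_germ m k t0 S D c" and zero: "S t0 = 0" and c: "0 < c"
  shows "\<forall>\<^sub>F t in at_right t0. 0 < S t"
    and "((\<lambda>t. D t / (2 * sqrt (S t))) \<longlongrightarrow> sqrt (c / 2)) (at_right t0)"
proof -
  have "((\<lambda>t. (D t)\<^sup>2 / (2 * S t)) \<longlongrightarrow> c) (at_right t0)"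
    using assms by (auto simp: XX_germ_def filterlim_at_split)
  from order_tendstoD(1)[OF this c] show pos: "\<forall>\<^sub>F t in at_right t0. 0 < S t"
    by eventually_elim (auto simp: zero_less_divide_iff)
  obtain d where "d > 0" and d: "\<And>h. 0 < h \<Longrightarrow> h < d \<Longrightarrow> D t0 < D (t0 + h)"
    using DERIV_pos_inc_right[of D c t0] germ c by (auto simp: XX_germ_def)
  have "\<forall>\<^sub>F t in at_right t0. 0 < D t"
    unfolding eventually_at_right_field
    using \<open>d > 0\<close> d[of "t - t0" for t] XX_germ_zero_deriv[OF germ zero] by (intro exI[of _ "t0 + d"]) auto
  with pos have "\<forall>\<^sub>F t in at_right t0. \<bar>D t / (2 * sqrt (S t))\<bar> = D t / (2 * sqrt (S t))"
    by eventually_elim simp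
  then show "((\<lambda>t. D t / (2 * sqrt (S t))) \<longlongrightarrow> sqrt (c / 2)) (at_right t0)"
    using XX_germ_slope_limit[OF germ zero pos] by (simp add: tendsto_cong)
qed

lemma XX_germ_unique_at_right_pos:
  assumes germ: "XX_germ m k t0 S1 D1 c" "XX_germ m k t0 S2 D2 c"
    and eq: "S1 t0 = S2 t0" "D1 t0 = D2 t0"
    and sgn: "0 < S1 t0 \<or> S1 t0 = 0 \<and> 0 < c"
  shows "\<forall>\<^sub>F t in at_right t0. S1 t = S2 t \<and> D1 t = D2 t"
proof -
  \<comment> \<open>The limit \<open>p\<close> of the slope of the square root depends on the data at \<open>t0\<close> only, hence is common to both solutions.\<close>
  have lim: "\<exists>p. \<forall>S D. XX_germ m k t0 S D c \<longrightarrow> S t0 = S1 t0 \<longrightarrow> D t0 = D1 t0 \<longrightarrow>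
     (\<forall>\<^sub>F t in at_right t0. 0 < S t) \<and> ((\<lambda>t. D t / (2 * sqrt (S t))) \<longlongrightarrow> p) (at_right t0)"
  proof (cases "S1 t0 = 0")
    case True
    then show ?thesis
      using sgn XX_germ_zero_limits_pos by (intro exI[of _ "sqrt (c / 2)"]) auto
  next
    case False
    have "(\<forall>\<^sub>F t in at_right t0. 0 < S t) \<and>
        ((\<lambda>t. D t / (2 * sqrt (S t))) \<longlongrightarrow> D1 t0 / (2 * sqrt (S1 t0))) (at_right t0)"
      if "XX_germ m k t0 S D c" "S t0 = S1 t0" "D t0 = D1 t0" for S D
    proof
      note lims = XX_germ_at_right(2,3)[OF that(1), unfolded that(2,3)]
      show "\<forall>\<^sub>F t in at_right t0. 0 < S t"
        using order_tendstoD(1)[OF lims(1)] sgn False by auto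
      show "((\<lambda>t. D t / (2 * sqrt (S t))) \<longlongrightarrow> D1 t0 / (2 * sqrt (S1 t0))) (at_right t0)"
        using False by (intro tendsto_intros lims) auto
    qed
    then show ?thesis by blast
  qed
  then obtain p where p: "\<And>S D. XX_germ m k t0 S D c \<Longrightarrow> S t0 = S1 t0 \<Longrightarrow> D t0 = D1 t0 \<Longrightarrow>
     (\<forall>\<^sub>F t in at_right t0. 0 < S t) \<and> ((\<lambda>t. D t / (2 * sqrt (S t))) \<longlongrightarrow> p) (at_right t0)"
    by blast
  note p1 = p[OF germ(1) refl refl] and p2 = p[OF germ(2) eq[symmetric]]
  show ?thesis
  proof (rule XX_ode_unique_at_right_pos)
    show "((\<lambda>t. sqrt (S1 t)) \<longlongrightarrow> sqrt (S1 t0)) (at_right t0)"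
      by (intro tendsto_intros XX_germ_at_right[OF germ(1)])
    show "((\<lambda>t. sqrt (S2 t)) \<longlongrightarrow> sqrt (S1 t0)) (at_right t0)"
      unfolding eq by (intro tendsto_intros XX_germ_at_right[OF germ(2)])
  qed (use p1 p2 XX_germ_at_right(1)[OF germ(1)] XX_germ_at_right(1)[OF germ(2)]
        in \<open>auto intro: eventually_conj\<close>)
qed

lemma XX_germ_unique_at_right:
  assumes germ: "XX_germ m k t0 S1 D1 c" "XX_germ m k t0 S2 D2 c"
    and eq: "S1 t0 = S2 t0" "D1 t0 = D2 t0"
  shows "\<forall>\<^sub>F t in at_right t0. S1 t = S2 t \<and> D1 t = D2 t"
proof (cases "0 < S1 t0 \<or> S1 t0 = 0 \<and> 0 < c")
  case True
  with assms show ?thesis by (rule XX_germ_unique_at_right_pos)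
next
  case False
  have "S1 t0 = 0 \<Longrightarrow> c \<noteq> 0" using XX_germ_zero_second_deriv_nonzero[OF germ(1)] .
  with False have "0 < - S1 t0 \<or> - S1 t0 = 0 \<and> 0 < - c" by auto
  from XX_germ_unique_at_right_pos[OF germ[THEN XX_germ_uminus] _ _ this] eq
  show ?thesis by simp
qed

lemma XX_germ_unique:
  assumes germ: "XX_germ m k t0 S1 D1 c" "XX_germ m k t0 S2 D2 c"
    and eq: "S1 t0 = S2 t0" "D1 t0 = D2 t0"
  shows "\<forall>\<^sub>F t in at t0. S1 t = S2 t \<and> D1 t = D2 t"
proof -
  have "\<forall>\<^sub>F t in at_right t0. S1 t = S2 t \<and> D1 t = D2 t"
    by (rule XX_germ_unique_at_right[OF germ eq])
  moreover have "\<forall>\<^sub>F t in at_right (- t0). S1 (- t) = S2 (- t) \<and> - D1 (- t) = - D2 (- t)"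
    by (rule XX_germ_unique_at_right[OF germ[THEN XX_germ_reflect]]) (use eq in auto)
  then have "\<forall>\<^sub>F t in at_left t0. S1 t = S2 t \<and> D1 t = D2 t"
    by (simp add: at_left_minus[of t0] eventually_filtermap)
  ultimately show ?thesis by (simp add: eventually_at_split)
qed

section \<open>Continuation along the interval\<close>

text \<open>
  Used for the differences of the solutions and of their derivatives: accumulating coincidences
  force the data up to second order to agree at the limit point.
\<close>

lemma frequently_zero_imp_deriv_zero:
  fixes f :: "real \<Rightarrow> real"
  assumes der: "(f has_real_derivative e) (at x)" and freq: "\<exists>\<^sub>F t in at x. f t = 0"
  shows "f x = 0 \<and> e = 0"
proof -
  have no: False if "(g \<longlongrightarrow> l) (at x)" "\<And>t. f t = 0 \<Longrightarrow> g t = 0" "l \<noteq> 0" for g and l :: real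
  proof -
    have "\<forall>\<^sub>F t in at x. g t \<noteq> 0" using that(1,3) by (rule tendsto_imp_eventually_ne)
    then have "\<forall>\<^sub>F t in at x. \<not> f t = 0" by eventually_elim (use that(2) in auto)
    with freq show False by (simp add: frequently_def)
  qed
  have "f x = 0"
    using no[of f] DERIV_isCont[OF der] by (auto simp: isCont_def)
  moreover have "((\<lambda>t. (f t - f x) / (t - x)) \<longlongrightarrow> e) (at x)"
    using der by (simp add: has_field_derivative_iff)
  ultimately show ?thesis using no[of "\<lambda>t. (f t - f x) / (t - x)" e] by auto
qed

lemma open_eventually_at:
  "open {x :: 'a :: t1_space. \<forall>\<^sub>F t in at x. P t}"
proof (subst open_subopen, safe)
  fix x :: 'a assume "\<forall>\<^sub>F t in at x. P t"
  then obtain U where U: "open U" "x \<in> U" "\<And>t. t \<in> U \<Longrightarrow> t \<noteq> x \<Longrightarrow> P t"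
    unfolding eventually_at_topological by blast
  have "\<forall>\<^sub>F t in at y. P t" if "y \<in> U" for y
  proof (cases "y = x")
    case True
    then show ?thesis using U by (auto simp: eventually_at_topological)
  next
    case False
    then show ?thesis unfolding eventually_at_topological
      using U that by (intro exI[of _ "U - {x}"]) (auto intro: open_delete)
  qed
  then show "\<exists>T. open T \<and> x \<in> T \<and> T \<subseteq> {x. \<forall>\<^sub>F t in at x. P t}" using U by blast
qed

lemma XX_solution_germ:
  assumes I: "open I" and sol: "XX_solution_on S I"
    and iso: "\<forall>z\<in>zeros_on S I. z isolated_in zeros_on S I" and x: "x \<in> I"
  shows "XX_germ 1 1 x S (deriv S) (deriv (deriv S) x)"
proof -
  have der: "(S has_real_derivative deriv S t) (at t)"
    "(deriv S has_real_derivative deriv (deriv S) t) (at t)" if "t \<in> I" for t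
    using sol that I
    by (auto simp: XX_solution_on_def twice_differentiable_on_def differentiable_on_eq_differentiable_at
      DERIV_deriv_iff_real_differentiable)
  have "\<forall>\<^sub>F t in at x. S t \<noteq> 0"
  proof (cases "S x = 0")
    case True
    then have "x isolated_in zeros_on S I" using iso x by (auto simp: zeros_on_def)
    then obtain T where "open T" "T \<inter> zeros_on S I = {x}" by (auto simp: isolated_in_def)
    then show ?thesis unfolding eventually_at_topological using I x
      by (intro exI[of _ "T \<inter> I"]) (auto simp: zeros_on_def)
  next
    case False
    have "(S \<longlongrightarrow> S x) (at x)" using DERIV_isCont[OF der(1)[OF x]] by (simp add: isCont_def)
    then show ?thesis using False by (rule tendsto_imp_eventually_ne)
  qed
  moreover have "\<forall>\<^sub>F t in at x. t \<in> I"
    using I x by (auto simp: eventually_at_topological)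
  ultimately have "\<forall>\<^sub>F t in at x. XX_ode 1 1 S (deriv S) t"
  proof eventually_elim
    case (elim t)
    then have "deriv (deriv S) t = (deriv S t)\<^sup>2 / (2 * S t) + 4 * 1 * (S t)\<^sup>2 + 2 * 1 * t * S t"
      using sol by (simp add: XX_solution_on_def)
    then show ?case using elim der[of t] by (simp add: XX_ode_def)
  qed
  moreover have "((\<lambda>t. (deriv S t)\<^sup>2 / (2 * S t)) \<longlongrightarrow> deriv (deriv S) x) (at x)" if "S x = 0"
  proof -
    have "x isolated_in zeros_on S I" using iso x that by (auto simp: zeros_on_def)
    then show ?thesis using sol x that by (auto simp: XX_solution_on_def)
  qed
  ultimately show ?thesis using der x by (simp add: XX_germ_def)
qed

theorem mainTheorem2:
  fixes I :: "real set" and a :: real and S1 S2 :: "real \<Rightarrow> real"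
  assumes "open I" and "is_interval I" and "a \<in> I"
    and "XX_solution_on S1 I" and "XX_solution_on S2 I"
    and "\<forall>z\<in>zeros_on S1 I. z isolated_in zeros_on S1 I"
    and "\<forall>z\<in>zeros_on S2 I. z isolated_in zeros_on S2 I"
    and "S1 a = 0" and "S2 a = 0"
    and "deriv (deriv S1) a = deriv (deriv S2) a"
  shows "\<forall>t\<in>I. S1 t = S2 t"
proof -
  define P where "P = (\<lambda>t. S1 t = S2 t \<and> deriv S1 t = deriv S2 t)"
  have germ1: "XX_germ 1 1 x S1 (deriv S1) (deriv (deriv S1) x)" if "x \<in> I" for x
    using XX_solution_germ[OF assms(1,4,6) that] .
  have germ2: "XX_germ 1 1 x S2 (deriv S2) (deriv (deriv S2) x)" if "x \<in> I" for x
    using XX_solution_germ[OF assms(1,5,7) that] .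
  have ev: "\<forall>\<^sub>F t in at x. P t" if "x \<in> I" "P x" "deriv (deriv S1) x = deriv (deriv S2) x" for x
    using XX_germ_unique[OF germ1[OF that(1)] germ2[OF that(1), folded that(3)]] that(2)
    by (simp add: P_def)
  have agree: "P x \<and> deriv (deriv S1) x = deriv (deriv S2) x"
    if "x \<in> I" "\<exists>\<^sub>F t in at x. P t" for x
  proof -
    have "((\<lambda>t. S1 t - S2 t) has_real_derivative deriv S1 x - deriv S2 x) (at x)"
      "((\<lambda>t. deriv S1 t - deriv S2 t) has_real_derivative deriv (deriv S1) x - deriv (deriv S2) x) (at x)"
      using germ1[OF that(1)] germ2[OF that(1)]
      by (auto simp: XX_germ_def intro!: derivative_intros)
    moreover have "\<exists>\<^sub>F t in at x. S1 t - S2 t = 0" "\<exists>\<^sub>F t in at x. deriv S1 t - deriv S2 t = 0"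
      using that(2) by (auto elim!: frequently_elim1 simp: P_def)
    ultimately show ?thesis
      using frequently_zero_imp_deriv_zero by (force simp: P_def)
  qed
  let ?U = "{x. \<forall>\<^sub>F t in at x. P t}" and ?V = "{x. \<forall>\<^sub>F t in at x. \<not> P t}"
  have "P a"
    using assms(8,9) XX_germ_zero_deriv[OF germ1[OF \<open>a \<in> I\<close>]]
      XX_germ_zero_deriv[OF germ2[OF \<open>a \<in> I\<close>]]
    by (simp add: P_def)
  then have "a \<in> ?U" using ev assms(3,10) by blast
  moreover have "I \<subseteq> ?U \<union> ?V"
    using agree ev by (auto simp: frequently_def)
  moreover have "?U \<inter> ?V \<inter> I = {}"
  proof -
    have False if "\<forall>\<^sub>F t in at x. P t" "\<forall>\<^sub>F t in at x. \<not> P t" for x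
      using eventually_conj[OF that] by simp
    then show ?thesis by blast
  qed
  moreover have "connected I" using assms(2) by (simp add: is_interval_connected_1)
  ultimately have "?V \<inter> I = {}"
    using connectedD[of I ?U ?V] open_eventually_at[of P] open_eventually_at[of "\<lambda>t. \<not> P t"] \<open>a \<in> I\<close>
    by blast
  with \<open>I \<subseteq> ?U \<union> ?V\<close> have "\<forall>\<^sub>F t in at x. P t" if "x \<in> I" for x using that by blast
  then show ?thesis
    using agree by (auto simp: P_def eventually_frequently)
qed

end
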